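(* Let $\ell$ be an odd prime and fix $\log_\ell$ as in the context. Any two Rado decorated graphs $(\Omega, f, g, \lambda)$ and $(\Omega', f', g', \lambda')$ are isomorphic, i.e. there is a bijection $\phi: \Omega \to \Omega'$ with $f'(\phi(v)) = f(v)$, $g'(\phi(x)) = g(x)$ and $\lambda'(\phi(v), \phi(w)) = \lambda(v,w)$ for all $v, w \in \Omega$ (for which these are defined) and $x \in \Omega_{\mathrm{fin}}$.
   Context: Fix an odd prime $\ell$ and an isomorphism of free rank-one $\mathbb{Z}_\ell$-modules $\log_\ell: 1 + \ell\mathbb{Z}_\ell \to \mathbb{Z}_\ell$; it maps $1 + \ell^{n+1}\mathbb{Z}_\ell$ onto $\ell^n\mathbb{Z}_\ell$, so $\log_\ell(1 + \ell\alpha) \bmod \ell^n$ depends only on $\alpha \bmod \ell^n$. Write $\mathbb{Z}/\ell^\infty\mathbb{Z} := \mathbb{Z}_\ell$. A decorated graph is a tuple $(\Omega, f, g, \lambda)$ where: $\Omega$ is a countably infinite set; $f: \Omega \to \mathbb{Z}_{\geq 1} \cup \{\infty\}$ has $f^{-1}(\infty)$ of size exactly $2$, its elements denoted $v_\ell(1), v_\ell(2)$, and $\Omega_{\mathrm{fin}} := f^{-1}(\mathbb{Z}_{\geq 1})$; $g$ assigns to each $v \in \Omega_{\mathrm{fin}}$ an element $g(v) \in (\mathbb{Z}/\ell^{f(v)}\mathbb{Z})^\ast$; $\lambda$ assigns to each ordered pair $(v,w)$ of distinct elements not both in $\{v_\ell(1), v_\ell(2)\}$ an element $\lambda(v,w)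 \in \mathbb{Z}/\ell^{f(v,w)}\mathbb{Z}$, where $f(v,w) := \min(f(v), f(w))$, such that $\lambda(v_\ell(1), w) \equiv \log_\ell(1 + g(w)\ell^{f(w)}) \bmod \ell^{f(w)}$ and $\lambda(w, v_\ell(i)) = 0$ for all $w \in \Omega_{\mathrm{fin}}$, $i \in \{1,2\}$. The decorated graph is Rado if for every finite $S \subseteq \Omega$ containing $\{v_\ell(1), v_\ell(2)\}$, every integer $n \geq 1$, every $\alpha \in (\mathbb{Z}/\ell^n\mathbb{Z})^\ast$ and all elements $\lambda_s(1), \lambda_s(2) \in \mathbb{Z}/\ell^{\min(n, f(s))}\mathbb{Z}$ ($s \in S$) with $\lambda_{v_\ell(1)}(2) \equiv \log_\ell(1 + \alpha\ell^n) \bmod \ell^n$ and $\lambda_{v_\ell(i)}(1) = 0$ for $i \in \{1,2\}$, there exists $v \in \Omega \setminus S$ with $f(v) = n$, $g(v) = \alpha$, and $\lambda(v,s) = \lambda_s(1)$, $\lambda(s,v) = \lambda_s(2)$ for all $s \in S$. *)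

theory Defs
  imports "HOL-Number_Theory.Residues" "HOL-Algebra.Module"
    "HOL-Library.Extended_Nat" "HOL-Library.Countable_Set"
begin

section \<open>The \<open>l\<close>-adic integers\<close>

text \<open>
  An \<open>l\<close>-adic integer is the coherent sequence of its residues, so \<open>x n\<close> is the class of \<open>x\<close>
  in \<open>\<int>/l^n\<int>\<close>, given by its representative in \<open>{0..l^n - 1}\<close>.
\<close>

type_synonym padic = "nat \<Rightarrow> int"

definition padic_ring :: "int \<Rightarrow> padic ring" where
  "padic_ring l =
    \<lparr>carrier = {x. \<forall>n. x n \<in> carrier (residue_ring (l ^ n)) \<and> x (Suc n) mod l ^ n = x n},
     monoid.mult = \<lambda>x y n. x n * y n mod l ^ n,
     one = \<lambda>n. 1 mod l ^ n,
     zero = \<lambda>n. 0,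
     add = \<lambda>x y n. (x n + y n) mod l ^ n\<rparr>"

definition padic_of_int :: "int \<Rightarrow> int \<Rightarrow> padic" where
  "padic_of_int l k = (\<lambda>n. k mod l ^ n)"

text \<open>The ring fields \<open>mult\<close> and \<open>one\<close> of the module records below play no role.\<close>

definition padic_module :: "int \<Rightarrow> (padic, padic) module" where
  "padic_module l =
    \<lparr>carrier = carrier (padic_ring l),
     monoid.mult = monoid.mult (padic_ring l), one = one (padic_ring l),
     zero = zero (padic_ring l), add = add (padic_ring l),
     smult = monoid.mult (padic_ring l)\<rparr>"

text \<open>
  The multiplicative group \<open>1 + l\<int>\<^sub>l\<close>, written additively, with \<open>\<int>\<^sub>l\<close> acting by exponentiation.
  For \<open>u \<in> 1 + l\<int>\<^sub>l\<close> the order of \<open>u\<close> modulo \<open>l^n\<close> divides \<open>l^n\<close>, so the residue of \<open>u^a\<close>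
  modulo \<open>l^n\<close> can be computed with the exponent \<open>a mod l^n\<close>.
\<close>

definition one_units :: "int \<Rightarrow> (padic, padic) module" where
  "one_units l =
    \<lparr>carrier = {\<one>\<^bsub>padic_ring l\<^esub> \<oplus>\<^bsub>padic_ring l\<^esub> (padic_of_int l l \<otimes>\<^bsub>padic_ring l\<^esub> x) | x.
        x \<in> carrier (padic_ring l)},
     monoid.mult = undefined, one = undefined,
     zero = one (padic_ring l), add = monoid.mult (padic_ring l),
     smult = \<lambda>a u n. u n ^ nat (a n) mod l ^ n\<rparr>"

definition module_iso ::
  "('r, 'm) ring_scheme \<Rightarrow> ('r, 'a, 'c) module_scheme \<Rightarrow> ('r, 'b, 'd) module_scheme \<Rightarrow> ('a \<Rightarrow> 'b) set"
where
  "module_iso R M N = {h. bij_betw h (carrier M) (carrier N) \<and>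
     (\<forall>x \<in> carrier M. \<forall>y \<in> carrier M. h (x \<oplus>\<^bsub>M\<^esub> y) = h x \<oplus>\<^bsub>N\<^esub> h y) \<and>
     (\<forall>a \<in> carrier R. \<forall>x \<in> carrier M. h (a \<odot>\<^bsub>M\<^esub> x) = a \<odot>\<^bsub>N\<^esub> h x)}"


section \<open>Decorated graphs\<close>

text \<open>
  The labelling \<open>vl1\<close>, \<open>vl2\<close> of the two vertices with \<open>f = \<infinity>\<close> is part of the data.  Elements of
  \<open>\<int>/l^n\<int>\<close> are represented in \<open>carrier (residue_ring (l^n))\<close>, so congruence of two of
  them is equality.
\<close>

record 'a decorated_graph_data =
  vertices :: "'a set"
  f :: "'a \<Rightarrow> enat"
  vl1 :: 'a
  vl2 :: 'a
  g :: "'a \<Rightarrow> int"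
  lam :: "'a \<Rightarrow> 'a \<Rightarrow> int"

definition fin_vertices :: "'a decorated_graph_data \<Rightarrow> 'a set" where
  "fin_vertices G = {v \<in> vertices G. f G v \<noteq> \<infinity>}"

text \<open>The ordered pairs on which \<open>\<lambda>\<close> is defined; \<open>min (f v) (f w)\<close> is finite there.\<close>

definition edge_pairs :: "'a decorated_graph_data \<Rightarrow> ('a \<times> 'a) set" where
  "edge_pairs G = {(v, w). v \<in> vertices G \<and> w \<in> vertices G \<and> v \<noteq> w \<and>
     \<not> (v \<in> {vl1 G, vl2 G} \<and> w \<in> {vl1 G, vl2 G})}"

text \<open>
  \<open>log\<^sub>l (1 + \<alpha> l^n) mod l^n\<close> for \<open>n \<ge> 1\<close> and \<open>\<alpha> \<in> \<int>/l^n\<int>\<close>, computed on the integer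
  representative of \<open>\<alpha>\<close>.  Since \<open>log\<^sub>l\<close> maps \<open>1 + l^(n+1)\<int>\<^sub>l\<close> onto \<open>l^n\<int>\<^sub>l\<close>, the choice of the
  representative does not matter.
\<close>

definition log_residue :: "int \<Rightarrow> (padic \<Rightarrow> padic) \<Rightarrow> int \<Rightarrow> nat \<Rightarrow> int" where
  "log_residue l logl \<alpha> n = logl (padic_of_int l (1 + \<alpha> * l ^ n)) n"

definition decorated_graph ::
  "int \<Rightarrow> (padic \<Rightarrow> padic) \<Rightarrow> 'a decorated_graph_data \<Rightarrow> bool" where
  "decorated_graph l logl G \<longleftrightarrow>
     countable (vertices G) \<and> infinite (vertices G) \<and>
     (\<forall>v \<in> vertices G. f G v \<ge> 1) \<and>
     vl1 G \<noteq> vl2 G \<and> {v \<in> vertices G. f G v = \<infinity>} = {vl1 G, vl2 G} \<and>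
     (\<forall>v \<in> fin_vertices G. g G v \<in> Units (residue_ring (l ^ the_enat (f G v)))) \<and>
     (\<forall>(v, w) \<in> edge_pairs G.
        lam G v w \<in> carrier (residue_ring (l ^ the_enat (min (f G v) (f G w))))) \<and>
     (\<forall>w \<in> fin_vertices G.
        lam G (vl1 G) w = log_residue l logl (g G w) (the_enat (f G w)) \<and>
        lam G w (vl1 G) = 0 \<and> lam G w (vl2 G) = 0)"

text \<open>Here \<open>a s\<close> and \<open>b s\<close> stand for \<open>\<lambda>\<^sub>s(1)\<close> and \<open>\<lambda>\<^sub>s(2)\<close>.\<close>

definition rado :: "int \<Rightarrow> (padic \<Rightarrow> padic) \<Rightarrow> 'a decorated_graph_data \<Rightarrow> bool" where
  "rado l logl G \<longleftrightarrow> decorated_graph l logl G \<and>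
     (\<forall>S n \<alpha> a b.
        finite S \<longrightarrow> S \<subseteq> vertices G \<longrightarrow> {vl1 G, vl2 G} \<subseteq> S \<longrightarrow>
        n \<ge> 1 \<longrightarrow> \<alpha> \<in> Units (residue_ring (l ^ n)) \<longrightarrow>
        (\<forall>s \<in> S. a s \<in> carrier (residue_ring (l ^ the_enat (min (enat n) (f G s)))) \<and>
                 b s \<in> carrier (residue_ring (l ^ the_enat (min (enat n) (f G s))))) \<longrightarrow>
        b (vl1 G) = log_residue l logl \<alpha> n \<longrightarrow>
        a (vl1 G) = 0 \<longrightarrow> a (vl2 G) = 0 \<longrightarrow>
        (\<exists>v \<in> vertices G - S. f G v = enat n \<and> g G v = \<alpha> \<and>
           (\<forall>s \<in> S. lam G v s = a s \<and> lam G s v = b s)))"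

definition decorated_graph_iso ::
  "'a decorated_graph_data \<Rightarrow> 'b decorated_graph_data \<Rightarrow> ('a \<Rightarrow> 'b) set" where
  "decorated_graph_iso G H = {\<phi>. bij_betw \<phi> (vertices G) (vertices H) \<and>
     (\<forall>v \<in> vertices G. f H (\<phi> v) = f G v) \<and>
     (\<forall>x \<in> fin_vertices G. g H (\<phi> x) = g G x) \<and>
     (\<forall>(v, w) \<in> edge_pairs G. lam H (\<phi> v) (\<phi> w) = lam G v w)}"


section \<open>\<open>\<int>\<^sub>l\<close> is a ring, and the two modules are modules\<close>

lemma padic_carrier_iff:
  "x \<in> carrier (padic_ring l) \<longleftrightarrow> (\<forall>n. x n \<in> {0..l ^ n - 1} \<and> x (Suc n) mod l ^ n = x n)"
  by (simp add: padic_ring_def residue_ring_def)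

lemma padic_carrierI:
  assumes "l > 1" and "\<And>n. x n = y n mod l ^ n" and "\<And>n. [y (Suc n) = y n] (mod l ^ n)"
  shows "x \<in> carrier (padic_ring l)"
proof -
  have "0 < l ^ n" for n using assms(1) by simp
  moreover have "x (Suc n) mod l ^ n = x n" for n
    using assms(2,3) by (metis cong_def dvd_triv_right mod_mod_cancel power_Suc)
  ultimately show ?thesis
    using assms(2) by (auto simp: padic_carrier_iff)
qed

lemma padic_cong: "x \<in> carrier (padic_ring l) \<Longrightarrow> [x (Suc n) = x n] (mod l ^ n)"
  by (metis padic_carrier_iff cong_def mod_mod_trivial)

lemma padic_mod: "l > 1 \<Longrightarrow> x \<in> carrier (padic_ring l) \<Longrightarrow> x n mod l ^ n = x n"
  by (metis padic_carrier_iff mod_mod_trivial)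

lemma padic_of_int_closed: "l > 1 \<Longrightarrow> padic_of_int l k \<in> carrier (padic_ring l)"
  by (rule padic_carrierI[where y = "\<lambda>_. k"]) (auto simp: padic_of_int_def)

lemma padic_cring:
  assumes l: "l > 1"
  shows "cring (padic_ring l)"
proof -
  let ?R = "padic_ring l"
  have add: "x \<oplus>\<^bsub>?R\<^esub> y = (\<lambda>n. (x n + y n) mod l ^ n)"
    and mult: "x \<otimes>\<^bsub>?R\<^esub> y = (\<lambda>n. x n * y n mod l ^ n)"
    and zero: "\<zero>\<^bsub>?R\<^esub> = (\<lambda>n. 0)" and one: "\<one>\<^bsub>?R\<^esub> = (\<lambda>n. 1 mod l ^ n)" for x y
    by (simp_all add: padic_ring_def)
  note ops = add mult zero one
  have closed: "x \<oplus>\<^bsub>?R\<^esub> y \<in> carrier ?R" "x \<otimes>\<^bsub>?R\<^esub> y \<in> carrier ?R"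
    if "x \<in> carrier ?R" "y \<in> carrier ?R" for x y
    unfolding ops
    using padic_cong[OF that(1)] padic_cong[OF that(2)]
    by (auto intro!: padic_carrierI[OF l] cong_add cong_mult)
  have neg: "(\<lambda>n. (- x n) mod l ^ n) \<in> carrier ?R" if "x \<in> carrier ?R" for x
    using padic_cong[OF that] 
    by (intro padic_carrierI[OF l, where y = "\<lambda>n. - x n"]) (auto simp: cong_minus_minus_iff)
  have c01: "\<zero>\<^bsub>?R\<^esub> \<in> carrier ?R" "\<one>\<^bsub>?R\<^esub> \<in> carrier ?R"
    unfolding ops by (rule padic_carrierI[OF l, where y = "\<lambda>_. 0"]; simp)
      (rule padic_carrierI[OF l, where y = "\<lambda>_. 1"]; simp)
  note m = padic_mod[OF l]
  have "abelian_group ?R"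
  proof (rule abelian_groupI)
    show "\<exists>y\<in>carrier ?R. y \<oplus>\<^bsub>?R\<^esub> x = \<zero>\<^bsub>?R\<^esub>" if "x \<in> carrier ?R" for x
      by (rule bexI[OF _ neg[OF that]]) (simp add: ops mod_simps)
  qed (auto simp: closed c01, auto simp: ops m mod_simps ac_simps)
  moreover have "comm_monoid ?R"
    by (rule comm_monoidI) (auto simp: closed c01, auto simp: ops m mod_simps ac_simps)
  ultimately show ?thesis
    by (rule cringI) (auto simp: ops mod_simps algebra_simps)
qed

lemma padic_module: "l > 1 \<Longrightarrow> module (padic_ring l) (padic_module l)"
proof -
  assume l: "l > 1"
  interpret R: cring "padic_ring l" by (rule padic_cring[OF l])
  have "abelian_group (padic_module l)"
    by (rule abelian_groupI)
      (auto simp: padic_module_def R.a_ac intro: R.l_neg R.a_inv_closed)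
  then show ?thesis
    by (intro moduleI R.cring_axioms) (auto simp: padic_module_def R.l_distr R.r_distr R.m_assoc)
qed

lemma one_units_iff:
  assumes l: "l > 1"
  shows "u \<in> carrier (one_units l) \<longleftrightarrow> u \<in> carrier (padic_ring l) \<and> u 1 = 1"
proof -
  let ?R = "padic_ring l"
  interpret R: cring ?R by (rule padic_cring[OF l])
  show ?thesis
  proof
    assume "u \<in> carrier (one_units l)"
    then obtain x where x: "x \<in> carrier ?R" "u = \<one>\<^bsub>?R\<^esub> \<oplus>\<^bsub>?R\<^esub> (padic_of_int l l \<otimes>\<^bsub>?R\<^esub> x)"
      by (auto simp: one_units_def)
    then have "u \<in> carrier ?R" using padic_of_int_closed[OF l] by simp
    moreover have "u 1 = 1" using l x(2) by (simp add: padic_ring_def padic_of_int_def)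
    ultimately show "u \<in> carrier ?R \<and> u 1 = 1" by simp
  next
    assume u: "u \<in> carrier ?R \<and> u 1 = 1"
    have u1: "[u (Suc n) = 1] (mod l)" for n
    proof (induction n)
      case 0 then show ?case using u by simp
    next
      case (Suc n)
      have "[u (Suc (Suc n)) = u (Suc n)] (mod l)"
        using padic_cong[of u l "Suc n"] u by (auto intro: cong_dvd_modulus)
      with Suc show ?case by (blast intro: cong_trans)
    qed
    define x where "x n = (u (Suc n) - 1) div l" for n
    have lx: "l * x n = u (Suc n) - 1" for n
      using u1[of n] by (simp add: x_def cong_iff_dvd_diff)
    have "[x (Suc n) = x n] (mod l ^ n)" for n
    proof -
      have "l * l ^ n dvd l * (x (Suc n) - x n)"
        using padic_cong[of u l "Suc n"] u 
        by (simp add: right_diff_distrib lx cong_iff_dvd_diff)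
      then show ?thesis using l by (simp add: cong_iff_dvd_diff)
    qed
    then have x: "(\<lambda>n. x n mod l ^ n) \<in> carrier ?R"
      by (intro padic_carrierI[OF l, where y = x]) auto
    have "u = \<one>\<^bsub>?R\<^esub> \<oplus>\<^bsub>?R\<^esub> (padic_of_int l l \<otimes>\<^bsub>?R\<^esub> (\<lambda>n. x n mod l ^ n))"
    proof
      fix n
      have "u n = u (Suc n) mod l ^ n" using u by (simp add: padic_carrier_iff)
      also have "u (Suc n) = 1 + l * x n" by (simp add: lx)
      finally show "u n = (\<one>\<^bsub>?R\<^esub> \<oplus>\<^bsub>?R\<^esub> (padic_of_int l l \<otimes>\<^bsub>?R\<^esub> (\<lambda>n. x n mod l ^ n))) n"
        by (simp add: padic_ring_def padic_of_int_def mod_simps)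
    qed
    with x show "u \<in> carrier (one_units l)" by (auto simp: one_units_def)
  qed
qed

lemma cong_1_power:
  fixes x l :: int
  assumes l: "l > 1" and x: "[x = 1] (mod l)"
  shows "[x ^ (nat l ^ n) = 1] (mod l ^ n)"
proof -
  have "[x ^ (nat l ^ n) = 1] (mod l ^ Suc n)"
  proof (induction n)
    case 0 then show ?case using x by simp
  next
    case (Suc n)
    let ?y = "x ^ (nat l ^ n)"
    have y: "[?y = 1] (mod l)" using cong_pow[OF x, of "nat l ^ n"] by simp
    have "[(\<Sum>i<nat l. ?y ^ i) = (\<Sum>i<nat l. 1)] (mod l)"
      by (intro cong_sum) (use cong_pow[OF y] in simp)
    also have "[(\<Sum>i<nat l. 1::int) = 0] (mod l)" using l by (simp add: cong_iff_dvd_diff)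
    finally have "l dvd (\<Sum>i<nat l. ?y ^ i)" by (simp add: cong_iff_dvd_diff)
    with Suc have "l ^ Suc n * l dvd (?y - 1) * (\<Sum>i<nat l. ?y ^ i)"
      by (intro mult_dvd_mono) (simp_all add: cong_iff_dvd_diff)
    also have "\<dots> = ?y ^ nat l - 1" by (simp add: power_diff_1_eq)
    finally show ?case
      by (simp add: cong_iff_dvd_diff power_mult[symmetric] mult.commute)
  qed
  then show ?thesis by (rule cong_dvd_modulus) simp
qed

lemma cong_power_exponent:
  fixes x l i j :: int
  assumes l: "l > 1" and x: "[x = 1] (mod l)"
    and ij: "[i = j] (mod l ^ n)" "i \<ge> 0" "j \<ge> 0"
  shows "[x ^ nat i = x ^ nat j] (mod l ^ n)"
proof -
  have *: "[x ^ nat i = x ^ nat (i mod l ^ n)] (mod l ^ n)" if "i \<ge> 0" for i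
  proof -
    have "nat i = nat l ^ n * nat (i div l ^ n) + nat (i mod l ^ n)"
      using that l by (simp add: nat_mult_distrib[symmetric] nat_power_eq[symmetric]
        nat_add_distrib[symmetric] pos_imp_zdiv_nonneg_iff)
    then have "x ^ nat i = (x ^ (nat l ^ n)) ^ nat (i div l ^ n) * x ^ nat (i mod l ^ n)"
      by (simp add: power_add power_mult)
    also have "[\<dots> = 1 ^ nat (i div l ^ n) * x ^ nat (i mod l ^ n)] (mod l ^ n)"
      by (intro cong_mult cong_pow cong_1_power l x cong_refl)
    finally show ?thesis by simp
  qed
  show ?thesis using *[of i] *[of j] ij by (metis cong_def)
qed

lemma one_units_module:
  assumes l: "l > 1"
  shows "module (padic_ring l) (one_units l)"
proof -
  let ?R = "padic_ring l" and ?U = "one_units l"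
  interpret R: cring ?R by (rule padic_cring[OF l])
  have u1: "[u n = 1] (mod l)" if "u \<in> carrier ?U" "n > 0" for u n
    using that(2)
  proof (induction n rule: nat_induct_non_zero)
    case 1 then show ?case using that(1) by (simp add: one_units_iff[OF l])
  next
    case (Suc n)
    have "[u (Suc n) = u n] (mod l)"
      using padic_cong[of u l n] that(1) Suc.hyps
      by (auto simp: one_units_iff[OF l] intro: cong_dvd_modulus)
    with Suc.IH show ?case by (blast intro: cong_trans)
  qed
  have add: "u \<oplus>\<^bsub>?U\<^esub> v = (\<lambda>n. u n * v n mod l ^ n)"
    and smult: "a \<odot>\<^bsub>?U\<^esub> u = (\<lambda>n. u n ^ nat (a n) mod l ^ n)"
    and zero: "\<zero>\<^bsub>?U\<^esub> = (\<lambda>n. 1 mod l ^ n)" for a u v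
    by (simp_all add: one_units_def padic_ring_def)
  have Radd: "x \<oplus>\<^bsub>?R\<^esub> y = (\<lambda>n. (x n + y n) mod l ^ n)"
    and Rmult: "x \<otimes>\<^bsub>?R\<^esub> y = (\<lambda>n. x n * y n mod l ^ n)"
    and Rone: "\<one>\<^bsub>?R\<^esub> = (\<lambda>n. 1 mod l ^ n)" for x y
    by (simp_all add: padic_ring_def)
  have nonneg: "a n \<ge> 0" if "a \<in> carrier ?R" for a n
    using that by (auto simp: padic_carrier_iff)
  have expo: "[u n ^ nat i = u n ^ nat j] (mod l ^ n)"
    if "u \<in> carrier ?U" "[i = j] (mod l ^ n)" "i \<ge> 0" "j \<ge> 0" for u n i j
    using cong_power_exponent[OF l u1 that(2-)] that(1) by (cases n) auto
  have UR: "u \<in> carrier ?R" if "u \<in> carrier ?U" for u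
    using that by (simp add: one_units_iff[OF l])
  have smult_closed: "a \<odot>\<^bsub>?U\<^esub> u \<in> carrier ?U" if a: "a \<in> carrier ?R" and u: "u \<in> carrier ?U" for a u
  proof -
    have "[u (Suc n) ^ nat (a (Suc n)) = u n ^ nat (a n)] (mod l ^ n)" for n
    proof -
      have "[u (Suc n) ^ nat (a (Suc n)) = u n ^ nat (a (Suc n))] (mod l ^ n)"
        by (intro cong_pow padic_cong UR u)
      also have "[u n ^ nat (a (Suc n)) = u n ^ nat (a n)] (mod l ^ n)"
        by (intro expo u padic_cong a nonneg)
      finally show ?thesis .
    qed
    then have "a \<odot>\<^bsub>?U\<^esub> u \<in> carrier ?R"
      unfolding smult by (intro padic_carrierI[OF l]) auto
    then show ?thesis using u l by (simp add: one_units_iff[OF l] smult)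
  qed
  have "abelian_group ?U"
  proof (rule abelian_groupI)
    fix u assume u: "u \<in> carrier ?U"
    let ?m = "\<lambda>n. (- 1) mod l ^ n"
    have m: "?m \<in> carrier ?R" by (rule padic_carrierI[OF l, where y = "\<lambda>_. -1"]) auto
    have "?m \<odot>\<^bsub>?U\<^esub> u \<oplus>\<^bsub>?U\<^esub> u = \<zero>\<^bsub>?U\<^esub>"
    proof
      fix n
      have "(?m \<odot>\<^bsub>?U\<^esub> u \<oplus>\<^bsub>?U\<^esub> u) n = u n ^ nat (?m n) * u n ^ nat 1 mod l ^ n"
        by (simp add: add smult mod_simps)
      also have "u n ^ nat (?m n) * u n ^ nat 1 = u n ^ nat (?m n + 1)"
        using l by (subst nat_add_distrib) (simp_all add: power_add)
      also have "[\<dots> = u n ^ nat 0] (mod l ^ n)"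
        using l by (intro expo u) (auto simp: cong_def mod_simps)
      then have "u n ^ nat (?m n + 1) mod l ^ n = 1 mod l ^ n" by (simp add: cong_def)
      finally show "(?m \<odot>\<^bsub>?U\<^esub> u \<oplus>\<^bsub>?U\<^esub> u) n = \<zero>\<^bsub>?U\<^esub> n" by (simp add: zero)
    qed
    with smult_closed[OF m u] show "\<exists>v\<in>carrier ?U. v \<oplus>\<^bsub>?U\<^esub> u = \<zero>\<^bsub>?U\<^esub>" by blast
  next
    fix u v assume uv: "u \<in> carrier ?U" "v \<in> carrier ?U"
    have "u \<oplus>\<^bsub>?U\<^esub> v = u \<otimes>\<^bsub>?R\<^esub> v" by (simp add: one_units_def)
    then have "u \<oplus>\<^bsub>?U\<^esub> v \<in> carrier ?R" using UR uv by simp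
    moreover have "(u \<oplus>\<^bsub>?U\<^esub> v) 1 = 1" using uv l by (simp add: one_units_iff[OF l] add)
    ultimately show "u \<oplus>\<^bsub>?U\<^esub> v \<in> carrier ?U" by (simp add: one_units_iff[OF l])
  next
    show "\<zero>\<^bsub>?U\<^esub> \<in> carrier ?U"
      using R.one_closed l by (simp add: one_units_iff[OF l] zero Rone)
  qed (auto simp: add zero mod_simps ac_simps padic_mod[OF l UR])
  then show ?thesis
  proof (intro moduleI R.cring_axioms smult_closed)
    fix a b u assume a: "a \<in> carrier ?R" and b: "b \<in> carrier ?R" and u: "u \<in> carrier ?U"
    show "(a \<oplus>\<^bsub>?R\<^esub> b) \<odot>\<^bsub>?U\<^esub> u = a \<odot>\<^bsub>?U\<^esub> u \<oplus>\<^bsub>?U\<^esub> b \<odot>\<^bsub>?U\<^esub> u"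
    proof
      fix n
      have "[u n ^ nat ((a n + b n) mod l ^ n) = u n ^ nat (a n + b n)] (mod l ^ n)"
        using l nonneg[OF a, of n] nonneg[OF b, of n] by (intro expo u) auto
      then show "((a \<oplus>\<^bsub>?R\<^esub> b) \<odot>\<^bsub>?U\<^esub> u) n = (a \<odot>\<^bsub>?U\<^esub> u \<oplus>\<^bsub>?U\<^esub> b \<odot>\<^bsub>?U\<^esub> u) n"
        using nonneg[OF a, of n] nonneg[OF b, of n]
        by (simp add: add smult Radd cong_def nat_add_distrib power_add mod_simps)
    qed
    show "(a \<otimes>\<^bsub>?R\<^esub> b) \<odot>\<^bsub>?U\<^esub> u = a \<odot>\<^bsub>?U\<^esub> (b \<odot>\<^bsub>?U\<^esub> u)"
    proof
      fix n
      have "[u n ^ nat (a n * b n mod l ^ n) = u n ^ nat (b n * a n)] (mod l ^ n)"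
        using l nonneg[OF a, of n] nonneg[OF b, of n]
        by (intro expo u) (auto simp: mult.commute)
      then show "((a \<otimes>\<^bsub>?R\<^esub> b) \<odot>\<^bsub>?U\<^esub> u) n = (a \<odot>\<^bsub>?U\<^esub> (b \<odot>\<^bsub>?U\<^esub> u)) n"
        using nonneg[OF a, of n] nonneg[OF b, of n]
        by (simp add: smult Rmult cong_def nat_mult_distrib power_mult power_mod)
    qed
  next
    fix a u v assume "a \<in> carrier ?R" "u \<in> carrier ?U" "v \<in> carrier ?U"
    show "a \<odot>\<^bsub>?U\<^esub> (u \<oplus>\<^bsub>?U\<^esub> v) = a \<odot>\<^bsub>?U\<^esub> u \<oplus>\<^bsub>?U\<^esub> a \<odot>\<^bsub>?U\<^esub> v"
      by (simp add: add smult power_mod mod_simps power_mult_distrib)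
  next
    fix u assume u: "u \<in> carrier ?U"
    show "\<one>\<^bsub>?R\<^esub> \<odot>\<^bsub>?U\<^esub> u = u"
    proof
      fix n
      have "[u n ^ nat (1 mod l ^ n) = u n ^ nat 1] (mod l ^ n)"
        using l by (intro expo u) auto
      then show "(\<one>\<^bsub>?R\<^esub> \<odot>\<^bsub>?U\<^esub> u) n = u n"
        using padic_mod[OF l UR[OF u]] by (simp add: smult Rone cong_def)
    qed
  qed
qed

end

theory Submission
  imports Defs
begin

text \<open>
  The isomorphism is built by back and forth.  A finite partial isomorphism matching the two
  infinite vertices extends to any further vertex \<open>v\<close>: \<open>v\<close> is finite, and the Rado property of
  the other graph realises its values \<open>f\<close>, \<open>g\<close> and \<open>\<lambda>\<close>.  The side conditions of the Rado
  property hold because they are imposed on \<open>v\<close> by the definition of a decorated graph.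
\<close>

section \<open>Back and forth between countable sets\<close>

text \<open>Stage \<open>n\<close> first puts the \<open>n\<close>-th element of \<open>A\<close>
  into the domain, then the \<open>n\<close>-th element of \<open>B\<close> into the range. The
  enumerations \<open>from_nat_into\<close> may repeat elements; this is harmless, since an
  extension step may return \<open>R\<close> itself. The invariant \<open>P\<close> is abstract so
  that finiteness can be carried along with it.\<close>

lemma back_and_forth:
  fixes P :: "('a \<times> 'b) set \<Rightarrow> bool"
  assumes "countable A" "countable B" "A \<noteq> {}" "B \<noteq> {}" and R0: "P R0"
    and dom_ext: "\<And>R x. P R \<Longrightarrow> x \<in> A \<Longrightarrow> \<exists>R'. P R' \<and> R \<subseteq> R' \<and> x \<in> Domain R'"
    and ran_ext: "\<And>R y. P R \<Longrightarrow> y \<in> B \<Longrightarrow> \<exists>R'. P R' \<and> R \<subseteq> R' \<and> y \<in> Range R'"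
  obtains C :: "nat \<Rightarrow> ('a \<times> 'b) set"
  where "incseq C" "\<And>n. P (C n)" "A \<subseteq> Domain (\<Union>n. C n)" "B \<subseteq> Range (\<Union>n. C n)"
proof -
  have step: "\<exists>R'. P R' \<and> (R \<subseteq> R' \<and> from_nat_into A n \<in> Domain R' \<and> from_nat_into B n \<in> Range R')"
    if R: "P R" for R n
  proof -
    obtain R1 where R1: "P R1" "R \<subseteq> R1" "from_nat_into A n \<in> Domain R1"
      using dom_ext[OF R from_nat_into[OF \<open>A \<noteq> {}\<close>]] by blast
    obtain R2 where R2: "P R2" "R1 \<subseteq> R2" "from_nat_into B n \<in> Range R2"
      using ran_ext[OF R1(1) from_nat_into[OF \<open>B \<noteq> {}\<close>]] by blast
    from R1 R2 show ?thesis by blast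
  qed
  obtain C where C: "\<And>n. P (C n)"
    "\<And>n. C n \<subseteq> C (Suc n) \<and> from_nat_into A n \<in> Domain (C (Suc n)) \<and>
      from_nat_into B n \<in> Range (C (Suc n))"
    using dependent_nat_choice[of "\<lambda>_ R. P R" "\<lambda>n R R'. R \<subseteq> R' \<and>
      from_nat_into A n \<in> Domain R' \<and> from_nat_into B n \<in> Range R'"] R0 step by metis
  show thesis
  proof
    show "incseq C" using C(2) by (simp add: incseq_SucI)
    show "P (C n)" for n by (rule C(1))
    show "A \<subseteq> Domain (\<Union>n. C n)"
    proof
      fix x assume "x \<in> A"
      then obtain n where "x = from_nat_into A n"
        using from_nat_into_surj[OF \<open>countable A\<close>] by metis
      with C(2)[of n] show "x \<in> Domain (\<Union>n. C n)" by blast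
    qed
    show "B \<subseteq> Range (\<Union>n. C n)"
    proof
      fix y assume "y \<in> B"
      then obtain n where "y = from_nat_into B n"
        using from_nat_into_surj[OF \<open>countable B\<close>] by metis
      with C(2)[of n] show "y \<in> Range (\<Union>n. C n)" by blast
    qed
  qed
qed

lemma decorated_graphD:
  assumes "decorated_graph l logl G"
  shows "countable (vertices G)" "infinite (vertices G)"
    and "v \<in> vertices G \<Longrightarrow> f G v \<ge> 1"
    and "vl1 G \<noteq> vl2 G" "{v \<in> vertices G. f G v = \<infinity>} = {vl1 G, vl2 G}"
    and "v \<in> fin_vertices G \<Longrightarrow> g G v \<in> Units (residue_ring (l ^ the_enat (f G v)))"
    and "(v, w) \<in> edge_pairs G \<Longrightarrow>
      lam G v w \<in> carrier (residue_ring (l ^ the_enat (min (f G v) (f G w))))"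
    and "v \<in> fin_vertices G \<Longrightarrow> lam G (vl1 G) v = log_residue l logl (g G v) (the_enat (f G v))"
    and "v \<in> fin_vertices G \<Longrightarrow> lam G v (vl1 G) = 0"
    and "v \<in> fin_vertices G \<Longrightarrow> lam G v (vl2 G) = 0"
proof -
  note G = assms[unfolded decorated_graph_def]
  show "countable (vertices G)" using G by (elim conjE)
  show "infinite (vertices G)" using G by (elim conjE)
  show "vl1 G \<noteq> vl2 G" using G by (elim conjE)
  show "{v \<in> vertices G. f G v = \<infinity>} = {vl1 G, vl2 G}" using G by (elim conjE)
  have "\<forall>v \<in> vertices G. f G v \<ge> 1" using G by (elim conjE)
  then show "v \<in> vertices G \<Longrightarrow> f G v \<ge> 1" by (rule bspec)
  have "\<forall>v \<in> fin_vertices G. g G v \<in> Units (residue_ring (l ^ the_enat (f G v)))"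
    using G by (elim conjE)
  then show "v \<in> fin_vertices G \<Longrightarrow> g G v \<in> Units (residue_ring (l ^ the_enat (f G v)))"
    by (rule bspec)
  have lam_carrier: "\<forall>(v, w) \<in> edge_pairs G.
      lam G v w \<in> carrier (residue_ring (l ^ the_enat (min (f G v) (f G w))))"
    using G by (elim conjE)
  show "lam G v w \<in> carrier (residue_ring (l ^ the_enat (min (f G v) (f G w))))"
    if "(v, w) \<in> edge_pairs G"
    using bspec[OF lam_carrier that] by (simp only: prod.case)
  have lam: "\<forall>w \<in> fin_vertices G.
      lam G (vl1 G) w = log_residue l logl (g G w) (the_enat (f G w)) \<and>
      lam G w (vl1 G) = 0 \<and> lam G w (vl2 G) = 0"
    using G by (elim conjE)
  show "lam G (vl1 G) v = log_residue l logl (g G v) (the_enat (f G v))"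
    "lam G v (vl1 G) = 0" "lam G v (vl2 G) = 0" if "v \<in> fin_vertices G"
    using bspec[OF lam that] by simp_all
qed

section \<open>Partial isomorphisms as relations\<close>

text \<open>A relation rather than a function, so that inverses and unions of chains are plain set
  operations. The equivalence \<open>x = y \<longleftrightarrow> x' = y'\<close> is
  single-valuedness and injectivity at once. Finiteness is left out because the union of the whole
  chain must qualify too.\<close>

definition partial_iso ::
  "'a decorated_graph_data \<Rightarrow> 'b decorated_graph_data \<Rightarrow> ('a \<times> 'b) set \<Rightarrow> bool" where
  "partial_iso G H R \<longleftrightarrow> R \<subseteq> vertices G \<times> vertices H \<and>
     (vl1 G, vl1 H) \<in> R \<and> (vl2 G, vl2 H) \<in> R \<and>
     (\<forall>(x, x') \<in> R. f H x' = f G x \<and> (f G x \<noteq> \<infinity> \<longrightarrow> g H x' = g G x)) \<and>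
     (\<forall>(x, x') \<in> R. \<forall>(y, y') \<in> R. (x = y \<longleftrightarrow> x' = y') \<and>
        ((x, y) \<in> edge_pairs G \<longrightarrow> lam H x' y' = lam G x y))"

lemma partial_iso_infinite:
  assumes "partial_iso G H R"
  shows "(vl1 G, vl1 H) \<in> R" "(vl2 G, vl2 H) \<in> R"
  using assms by (simp_all only: partial_iso_def)

lemma partial_iso_pair:
  assumes R: "partial_iso G H R" and xy: "(x, x') \<in> R" "(y, y') \<in> R"
  shows "x = y \<longleftrightarrow> x' = y'" "(x, y) \<in> edge_pairs G \<Longrightarrow> lam H x' y' = lam G x y"
proof -
  have "\<forall>(x, x') \<in> R. \<forall>(y, y') \<in> R. (x = y \<longleftrightarrow> x' = y') \<and>
      ((x, y) \<in> edge_pairs G \<longrightarrow> lam H x' y' = lam G x y)"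
    using R unfolding partial_iso_def by (elim conjE)
  from bspec[OF this xy(1)] have "\<forall>(y, y') \<in> R. (x = y \<longleftrightarrow> x' = y') \<and>
      ((x, y) \<in> edge_pairs G \<longrightarrow> lam H x' y' = lam G x y)"
    by (simp only: prod.case)
  from bspec[OF this xy(2)] show "x = y \<longleftrightarrow> x' = y'"
    "(x, y) \<in> edge_pairs G \<Longrightarrow> lam H x' y' = lam G x y"
    by simp_all
qed

lemma partial_iso_vertex:
  assumes R: "partial_iso G H R" and x: "(x, x') \<in> R"
  shows "x \<in> vertices G" "x' \<in> vertices H" "f H x' = f G x" "f G x \<noteq> \<infinity> \<Longrightarrow> g H x' = g G x"
    "x = vl1 G \<longleftrightarrow> x' = vl1 H" "x = vl2 G \<longleftrightarrow> x' = vl2 H"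
proof -
  have "R \<subseteq> vertices G \<times> vertices H" using R unfolding partial_iso_def by (elim conjE)
  from subsetD[OF this x] show "x \<in> vertices G" "x' \<in> vertices H" by simp_all
  have "\<forall>(x, x') \<in> R. f H x' = f G x \<and> (f G x \<noteq> \<infinity> \<longrightarrow> g H x' = g G x)"
    using R unfolding partial_iso_def by (elim conjE)
  from bspec[OF this x] show "f H x' = f G x" "f G x \<noteq> \<infinity> \<Longrightarrow> g H x' = g G x" by simp_all
  \<comment> \<open>Compare \<open>(x, x')\<close> with the two pairs of infinite vertices.\<close>
  show "x = vl1 G \<longleftrightarrow> x' = vl1 H" "x = vl2 G \<longleftrightarrow> x' = vl2 H"
    using partial_iso_pair(1)[OF R x] partial_iso_infinite[OF R] by simp_all
qed

text \<open>For vertices, being an edge pair depends only on whether the two entries coincide and on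
  which of them are \<open>vl1\<close> or \<open>vl2\<close>; a partial isomorphism respects
  both.\<close>

lemma partial_iso_edge_pairs:
  assumes "partial_iso G H R" "(x, x') \<in> R" "(y, y') \<in> R"
  shows "(x, y) \<in> edge_pairs G \<longleftrightarrow> (x', y') \<in> edge_pairs H"
  using partial_iso_vertex[OF assms(1,2)] partial_iso_vertex[OF assms(1,3)]
    partial_iso_pair(1)[OF assms]
  by (simp add: edge_pairs_def)

text \<open>This symmetry turns the back step into a forth step with the graphs exchanged. The
  condition on \<open>lam\<close> quantifies over edge pairs of the first graph only, so edge pairs
  have to be transferred.\<close>

lemma partial_iso_converse:
  assumes R: "partial_iso G H R"
  shows "partial_iso H G (R\<inverse>)"
  unfolding partial_iso_def
proof (intro conjI)
  show "R\<inverse> \<subseteq> vertices H \<times> vertices G" "(vl1 H, vl1 G) \<in> R\<inverse>" "(vl2 H, vl2 G) \<in> R\<inverse>"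
    using R unfolding partial_iso_def by blast+
  show "\<forall>(x, x') \<in> R\<inverse>. f G x' = f H x \<and> (f H x \<noteq> \<infinity> \<longrightarrow> g G x' = g H x)"
    using partial_iso_vertex(3,4)[OF R] by auto
  show "\<forall>(x, x') \<in> R\<inverse>. \<forall>(y, y') \<in> R\<inverse>. (x = y \<longleftrightarrow> x' = y') \<and>
      ((x, y) \<in> edge_pairs H \<longrightarrow> lam G x' y' = lam H x y)"
    using partial_iso_pair[OF R] partial_iso_edge_pairs[OF R] by auto
qed

section \<open>The one-point extension\<close>

text \<open>The Rado property is asked of the graph in which the new vertex is sought, with
  \<open>Range R\<close> as the finite set \<open>S\<close>; hence the finiteness of
  \<open>R\<close> is maintained.\<close>

lemma partial_iso_extend:
  assumes G: "decorated_graph l logl G" and H: "rado l logl H"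
    and R: "partial_iso G H R" "finite R" and v: "v \<in> vertices G"
  obtains R' where "partial_iso G H R'" "finite R'" "R \<subseteq> R'" "v \<in> Domain R'"
proof (cases "v \<in> Domain R")
  case True
  with that R show thesis by blast
next
  case False
  note vl = partial_iso_infinite[OF R(1)]
  have v_vl: "v \<noteq> vl1 G" "v \<noteq> vl2 G" using False vl by auto
  have "{v \<in> vertices G. f G v = \<infinity>} = {vl1 G, vl2 G}"
    by (rule decorated_graphD(5)[OF G])
  with v v_vl have fin: "f G v \<noteq> \<infinity>" by auto
  then obtain n where n: "f G v = enat n" by auto
  have vfin: "v \<in> fin_vertices G" using v fin by (simp add: fin_vertices_def)
  have n1: "n \<ge> 1"
    using decorated_graphD(3)[OF G v] n by (simp add: one_enat_def)
  have unit: "g G v \<in> Units (residue_ring (l ^ n))"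
    using decorated_graphD(6)[OF G vfin] n by simp
  \<comment> \<open>As \<open>v\<close> is neither infinite vertex, \<open>lam\<close> is defined
    between \<open>v\<close> and every vertex of \<open>Domain R\<close>, in both
    directions.\<close>
  have pairs: "(v, s) \<in> edge_pairs G" "(s, v) \<in> edge_pairs G" if "(s, s') \<in> R" for s s'
    using that False v v_vl partial_iso_vertex(1)[OF R(1) that] by (auto simp: edge_pairs_def)
  note lam_carrier = decorated_graphD(7)[OF G]
  \<comment> \<open>\<open>log_residue\<close> sees the graph only through \<open>g G v\<close> and
    \<open>n\<close>, so the value forced at \<open>vl1\<close> in \<open>G\<close> is the one
    prescribed by the Rado property of \<open>H\<close>.\<close>
  have lam_vl: "lam G (vl1 G) v = log_residue l logl (g G v) n"
    "lam G v (vl1 G) = 0" "lam G v (vl2 G) = 0"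
    using decorated_graphD(8-10)[OF G vfin] n by simp_all
  \<comment> \<open>\<open>q\<close> is the inverse of \<open>R\<close> on \<open>Range R\<close>,
    well defined by injectivity. It transports the values of \<open>lam\<close> at \<open>v\<close>
    to functions \<open>?a\<close>, \<open>?b\<close> on vertices of \<open>H\<close>.\<close>
  define q where "q s' = (THE s. (s, s') \<in> R)" for s'
  have q: "q s' = s" if "(s, s') \<in> R" for s s'
    unfolding q_def using that partial_iso_pair(1)[OF R(1) _ that] by blast
  let ?S = "Range R" and ?a = "\<lambda>s'. lam G v (q s')" and ?b = "\<lambda>s'. lam G (q s') v"
  have S: "finite ?S" "?S \<subseteq> vertices H" "{vl1 H, vl2 H} \<subseteq> ?S"
    using R vl partial_iso_vertex(2)[OF R(1)] by (auto intro: finite_Range)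
  \<comment> \<open>The moduli agree because matched vertices have equal \<open>f\<close>.\<close>
  have ab: "\<forall>s'\<in>?S. ?a s' \<in> carrier (residue_ring (l ^ the_enat (min (enat n) (f H s')))) \<and>
      ?b s' \<in> carrier (residue_ring (l ^ the_enat (min (enat n) (f H s'))))"
  proof
    fix s' assume "s' \<in> ?S"
    then obtain s where s: "(s, s') \<in> R" by blast
    then show "?a s' \<in> carrier (residue_ring (l ^ the_enat (min (enat n) (f H s')))) \<and>
        ?b s' \<in> carrier (residue_ring (l ^ the_enat (min (enat n) (f H s'))))"
      using lam_carrier[OF pairs(1)[OF s]] lam_carrier[OF pairs(2)[OF s]]
      by (simp add: q[OF s] n partial_iso_vertex(3)[OF R(1) s] min.commute)
  qed
  have "\<exists>v'\<in>vertices H - ?S. f H v' = enat n \<and> g H v' = g G v \<and>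
      (\<forall>s'\<in>?S. lam H v' s' = ?a s' \<and> lam H s' v' = ?b s')"
  proof -
    have ext: "finite S \<longrightarrow> S \<subseteq> vertices H \<longrightarrow> {vl1 H, vl2 H} \<subseteq> S \<longrightarrow>
        n \<ge> 1 \<longrightarrow> \<alpha> \<in> Units (residue_ring (l ^ n)) \<longrightarrow>
        (\<forall>s \<in> S. a s \<in> carrier (residue_ring (l ^ the_enat (min (enat n) (f H s)))) \<and>
                 b s \<in> carrier (residue_ring (l ^ the_enat (min (enat n) (f H s))))) \<longrightarrow>
        b (vl1 H) = log_residue l logl \<alpha> n \<longrightarrow>
        a (vl1 H) = 0 \<longrightarrow> a (vl2 H) = 0 \<longrightarrow>
        (\<exists>v \<in> vertices H - S. f H v = enat n \<and> g H v = \<alpha> \<and>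
           (\<forall>s \<in> S. lam H v s = a s \<and> lam H s v = b s))" for S n \<alpha> a b
      using H unfolding rado_def by blast
    \<comment> \<open>Since \<open>q\<close> sends \<open>vl1 H\<close> to \<open>vl1 G\<close> and
      \<open>vl2 H\<close> to \<open>vl2 G\<close>, the three remaining side conditions become the
      facts \<open>lam_vl\<close>.\<close>
    show ?thesis
      by (rule ext[rule_format, OF S n1 unit ab[rule_format]])
        (simp_all add: q[OF vl(1)] q[OF vl(2)] lam_vl)
  qed
  then obtain v' where v': "v' \<in> vertices H" "v' \<notin> ?S" "f H v' = enat n" "g H v' = g G v"
    "\<And>s'. s' \<in> ?S \<Longrightarrow> lam H v' s' = ?a s' \<and> lam H s' v' = ?b s'"
    by blast
  have lam': "lam H v' s' = lam G v s" "lam H s' v' = lam G s v" if "(s, s') \<in> R" for s s'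
    using v'(5)[of s'] that by (auto simp: q[OF that])
  have "partial_iso G H (insert (v, v') R)"
    unfolding partial_iso_def
  proof (intro conjI)
    show "insert (v, v') R \<subseteq> vertices G \<times> vertices H"
      using v v'(1) R(1) unfolding partial_iso_def by blast
    show "(vl1 G, vl1 H) \<in> insert (v, v') R" "(vl2 G, vl2 H) \<in> insert (v, v') R"
      using vl by blast+
    show "\<forall>(x, x') \<in> insert (v, v') R. f H x' = f G x \<and> (f G x \<noteq> \<infinity> \<longrightarrow> g H x' = g G x)"
      using v'(3,4) n partial_iso_vertex(3,4)[OF R(1)] by auto
    show "\<forall>(x, x') \<in> insert (v, v') R. \<forall>(y, y') \<in> insert (v, v') R. (x = y \<longleftrightarrow> x' = y') \<and>
        ((x, y) \<in> edge_pairs G \<longrightarrow> lam H x' y' = lam G x y)"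
    proof (clarify, intro conjI impI)
      fix x x' y y'
      assume x: "(x, x') \<in> insert (v, v') R" and y: "(y, y') \<in> insert (v, v') R"
      \<comment> \<open>The new pair is fresh on both sides: \<open>v\<close> is outside
        \<open>Domain R\<close> and \<open>v'\<close> outside \<open>Range R\<close>.\<close>
      show "x = y \<longleftrightarrow> x' = y'"
        using x y False v'(2) partial_iso_pair(1)[OF R(1), of x x' y y'] by auto
      assume xy: "(x, y) \<in> edge_pairs G"
      \<comment> \<open>This excludes that both pairs are the new one; one new pair is handled by
        \<open>lam'\<close>, none by the assumption on \<open>R\<close>.\<close>
      then have "x \<noteq> y" by (simp add: edge_pairs_def)
      with x y xy show "lam H x' y' = lam G x y"
        using lam' partial_iso_pair(2)[OF R(1), of x x' y y'] by auto
    qed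
  qed
  with that[of "insert (v, v') R"] R(2) show thesis by auto
qed

section \<open>Start, limit and end of the construction\<close>

text \<open>The conditions on \<open>g\<close> and \<open>lam\<close> are vacuous here:
  \<open>f\<close> is infinite at both vertices, and no edge pair lies inside
  \<open>{vl1 G, vl2 G}\<close>.\<close>

lemma partial_iso_initial:
  assumes G: "decorated_graph l logl G" and H: "decorated_graph l logl H"
  shows "partial_iso G H {(vl1 G, vl1 H), (vl2 G, vl2 H)}"
proof -
  note G = decorated_graphD(4,5)[OF G] and H = decorated_graphD(4,5)[OF H]
  from G(2) H(2) have "vl1 G \<in> vertices G" "f G (vl1 G) = \<infinity>" "vl2 G \<in> vertices G" "f G (vl2 G) = \<infinity>"
    "vl1 H \<in> vertices H" "f H (vl1 H) = \<infinity>" "vl2 H \<in> vertices H" "f H (vl2 H) = \<infinity>"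
    by blast+
  with G(1) H(1) show ?thesis by (auto simp: partial_iso_def edge_pairs_def)
qed

text \<open>Each condition concerns at most two pairs of the relation, and any two pairs of the
  union already lie in a common member of the chain.\<close>

lemma partial_iso_UN:
  fixes C :: "nat \<Rightarrow> ('a \<times> 'b) set"
  assumes C: "incseq C" "\<And>n. partial_iso G H (C n)"
  shows "partial_iso G H (\<Union>n. C n)"
proof -
  have *: "\<exists>n. p \<in> C n \<and> q \<in> C n" if pq: "p \<in> (\<Union>n. C n)" "q \<in> (\<Union>n. C n)" for p q
  proof -
    from pq obtain i j where "p \<in> C i" "q \<in> C j" by blast
    with C(1) have "p \<in> C (max i j)" "q \<in> C (max i j)"
      by (meson incseqD max.cobounded1 max.cobounded2 subsetD)+
    then show ?thesis by blast
  qed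
  show ?thesis
    unfolding partial_iso_def
  proof (intro conjI)
    show "(\<Union>n. C n) \<subseteq> vertices G \<times> vertices H"
      "(vl1 G, vl1 H) \<in> (\<Union>n. C n)" "(vl2 G, vl2 H) \<in> (\<Union>n. C n)"
      using C(2) unfolding partial_iso_def by blast+
    show "\<forall>(x, x') \<in> (\<Union>n. C n). f H x' = f G x \<and> (f G x \<noteq> \<infinity> \<longrightarrow> g H x' = g G x)"
      using partial_iso_vertex(3,4)[OF C(2)] by blast
    show "\<forall>(x, x') \<in> (\<Union>n. C n). \<forall>(y, y') \<in> (\<Union>n. C n). (x = y \<longleftrightarrow> x' = y') \<and>
        ((x, y) \<in> edge_pairs G \<longrightarrow> lam H x' y' = lam G x y)"
    proof (clarify, intro conjI impI)
      fix x x' i y y' j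
      assume "(x, x') \<in> C i" "(y, y') \<in> C j"
      then obtain n where n: "(x, x') \<in> C n" "(y, y') \<in> C n"
        using *[of "(x, x')" "(y, y')"] by blast
      show "x = y \<longleftrightarrow> x' = y'" by (rule partial_iso_pair(1)[OF C(2) n])
      show "lam H x' y' = lam G x y" if "(x, y) \<in> edge_pairs G"
        by (rule partial_iso_pair(2)[OF C(2) n that])
    qed
  qed
qed

text \<open>A choice function for \<open>R\<close> is the isomorphism. It is onto because
  single-valuedness forces its value at any \<open>x\<close> related to \<open>y\<close> to be
  \<open>y\<close>.\<close>

lemma decorated_graph_iso_of_partial_iso:
  assumes R: "partial_iso G H R"
    and total: "vertices G \<subseteq> Domain R" "vertices H \<subseteq> Range R"
  shows "\<exists>\<phi>. \<phi> \<in> decorated_graph_iso G H"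
proof -
  have "\<forall>x \<in> vertices G. \<exists>y. (x, y) \<in> R" using total(1) by blast
  then obtain \<phi> where \<phi>: "\<And>x. x \<in> vertices G \<Longrightarrow> (x, \<phi> x) \<in> R"
    by (auto dest!: bchoice)
  have "bij_betw \<phi> (vertices G) (vertices H)"
  proof (rule bij_betw_imageI)
    show "inj_on \<phi> (vertices G)"
      by (rule inj_onI) (use partial_iso_pair(1)[OF R \<phi> \<phi>] in blast)
    have "y \<in> \<phi> ` vertices G" if y: "y \<in> vertices H" for y
    proof -
      obtain x where x: "(x, y) \<in> R" using subsetD[OF total(2) y] by blast
      note x_G = partial_iso_vertex(1)[OF R x]
      have "y = \<phi> x" using partial_iso_pair(1)[OF R x \<phi>[OF x_G]] by simp
      with x_G show ?thesis by blast
    qed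
    moreover have "\<phi> x \<in> vertices H" if "x \<in> vertices G" for x
      by (rule partial_iso_vertex(2)[OF R \<phi>[OF that]])
    ultimately show "\<phi> ` vertices G = vertices H" by blast
  qed
  moreover have "lam H (\<phi> v) (\<phi> w) = lam G v w" if "(v, w) \<in> edge_pairs G" for v w
    using that partial_iso_pair(2)[OF R \<phi> \<phi> that] by (simp add: edge_pairs_def)
  ultimately have "\<phi> \<in> decorated_graph_iso G H"
    using partial_iso_vertex(3,4)[OF R \<phi>]
    by (auto simp: decorated_graph_iso_def fin_vertices_def)
  then show ?thesis by (rule exI[where x = \<phi>])
qed

theorem theorem2p6:
  fixes l :: int and logl :: "padic \<Rightarrow> padic"
    and G :: "'a decorated_graph_data" and H :: "'b decorated_graph_data"
  assumes "prime l" and "odd l"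
    and "logl \<in> module_iso (padic_ring l) (one_units l) (padic_module l)"
    and "rado l logl G" and "rado l logl H"
  shows "\<exists>\<phi>. \<phi> \<in> decorated_graph_iso G H"
proof -
  have dG: "decorated_graph l logl G" and dH: "decorated_graph l logl H"
    using assms(4,5) unfolding rado_def by blast+
  have countable: "countable (vertices G)" "countable (vertices H)"
    and nonempty: "vertices G \<noteq> {}" "vertices H \<noteq> {}"
    using decorated_graphD(1,2)[OF dG] decorated_graphD(1,2)[OF dH] by auto
  \<comment> \<open>Finiteness belongs to the invariant of the stages, as each extension requires
    it; the union keeps only \<open>partial_iso\<close>.\<close>
  let ?P = "\<lambda>R. partial_iso G H R \<and> finite R"
  have init: "?P {(vl1 G, vl1 H), (vl2 G, vl2 H)}"
    using partial_iso_initial[OF dG dH] by simp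
  have dom_ext: "\<exists>R'. ?P R' \<and> R \<subseteq> R' \<and> x \<in> Domain R'" if R: "?P R" and x: "x \<in> vertices G" for R x
  proof -
    have "partial_iso G H R" "finite R" using R by simp_all
    then obtain R' where "partial_iso G H R'" "finite R'" "R \<subseteq> R'" "x \<in> Domain R'"
      by (rule partial_iso_extend[OF dG assms(5) _ _ x])
    then show ?thesis by blast
  qed
  have ran_ext: "\<exists>R'. ?P R' \<and> R \<subseteq> R' \<and> y \<in> Range R'" if R: "?P R" and y: "y \<in> vertices H" for R y
  proof -
    \<comment> \<open>The back step: extend the converse relation with the Rado property of
      \<open>G\<close>, then invert again.\<close>
    have "partial_iso H G (R\<inverse>)" "finite (R\<inverse>)"
      using R by (simp_all add: partial_iso_converse)
    then obtain Q where Q: "partial_iso H G Q" "finite Q" "R\<inverse> \<subseteq> Q" "y \<in> Domain Q"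
      by (rule partial_iso_extend[OF dH assms(4) _ _ y])
    then have "?P (Q\<inverse>)" by (simp add: partial_iso_converse)
    moreover have "R \<subseteq> Q\<inverse>" "y \<in> Range (Q\<inverse>)" using Q(3,4) by auto
    ultimately show ?thesis by blast
  qed
  obtain C where C: "incseq C" "\<And>n. ?P (C n)"
    "vertices G \<subseteq> Domain (\<Union>n. C n)" "vertices H \<subseteq> Range (\<Union>n. C n)"
    by (rule back_and_forth[where P = ?P, OF countable nonempty init dom_ext ran_ext]) blast+
  show ?thesis
    by (rule decorated_graph_iso_of_partial_iso[OF partial_iso_UN C(3,4)]) (use C in auto)
qed

end
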